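(* Let $I$ be a non-empty index set, let $\mathfrak{M}=\{Y_i: i\in I\}$ be a family of non-empty metric spaces, and let the metric space $X$ be a disjoint union $X=\coprod_{i\in I}Y_i$. Then $X$ is a minimal $\mathfrak{M}$-universal metric space if and only if the following statements hold. (i) Every $Y_i\in\mathfrak{M}$ is not shifted. (ii) The metric spaces $Y_i$ and $Y_j$ are incomparable for distinct $i,j\in I$. (iii) For every $Y_i\in\mathfrak{M}$ there is a unique $X^i\subseteq X$ such that $Y_i\simeq X^i$.
   Context: For metric spaces $X,Y$, write $X\hookrightarrow Y$ if there is an isometric embedding (distance-preserving map) of $X$ in $Y$, and $X\simeq Y$ if $X$ and $Y$ are isometric. Subsets of metric spaces are regarded as subspaces with the induced metric. $X,Y$ are comparable if $X\hookrightarrow Y$ or $Y\hookrightarrow X$; otherwise incomparable. A metric space $Y$ is shifted if there is $X\subseteq Y$ with $X\simeq Y$ and $Y\setminus X\neq\varnothing$; otherwise it is not shifted. A metric space $Y$ is $\mathfrak{M}$-universal (written $\mathfrak{M}\hookrightarrow Y$) if $Z\hookrightarrow Y$ for every $Z\in\mathfrak{M}$; an $\mathfrak{M}$-universal $Y$ is minimal $\mathfrak{M}$-universal if for every subspace $Y_0\subseteq Y$, $\mathfrak{M}\hookrightarrow Y_0$ implies $Y_0=Y$. A metric space $X$ is a disjoint union of metric spaces $Y_i$, $i\in I$, written $X=\coprod_{i\in I}Y_i$, if there is a partition $\{X_i:i\in I\}$ of the set $X$ (i.e. $X=\bigcup_{i\in I}X_i$, $X_i\neq\varnothing$, and $X_i\cap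 X_j=\varnothing$ for distinct $i,j$) such that $X_i\simeq Y_i$ for every $i\in I$, where $X_i$ carries the metric induced from $X$. (No condition is imposed on distances between points of different parts, beyond $X$ being a metric space.) *)

theory Defs
  imports "HOL-Analysis.Analysis"
begin

text \<open>Metric spaces are elements of the type \<^typ>\<open>'a metric\<close>, whose carrier \<^term>\<open>mspace X\<close>
  is an arbitrary, possibly empty, set; the space induced on a subset \<open>S\<close> of the carrier is
  \<^term>\<open>submetric X S\<close>. Since \<^term>\<open>mdist X\<close> is also defined outside the carrier, two subspaces of
  a space are compared by their carriers.\<close>

definition distance_preserving :: "'a metric \<Rightarrow> 'b metric \<Rightarrow> ('a \<Rightarrow> 'b) \<Rightarrow> bool" where
  "distance_preserving X Y f \<longleftrightarrow>
     f \<in> mspace X \<rightarrow> mspace Y \<and>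
     (\<forall>x\<in>mspace X. \<forall>y\<in>mspace X. mdist Y (f x) (f y) = mdist X x y)"

definition embeds :: "'a metric \<Rightarrow> 'b metric \<Rightarrow> bool" where
  "embeds X Y \<longleftrightarrow> (\<exists>f. distance_preserving X Y f)"

definition isometric :: "'a metric \<Rightarrow> 'b metric \<Rightarrow> bool" where
  "isometric X Y \<longleftrightarrow> (\<exists>f. distance_preserving X Y f \<and> bij_betw f (mspace X) (mspace Y))"

definition comparable :: "'a metric \<Rightarrow> 'b metric \<Rightarrow> bool" where
  "comparable X Y \<longleftrightarrow> embeds X Y \<or> embeds Y X"

definition shifted :: "'a metric \<Rightarrow> bool" where
  "shifted Y \<longleftrightarrow> (\<exists>S\<subseteq>mspace Y. isometric (submetric Y S) Y \<and> mspace Y - S \<noteq> {})"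

definition universal :: "'a metric set \<Rightarrow> 'b metric \<Rightarrow> bool" where
  "universal \<MM> Y \<longleftrightarrow> (\<forall>Z\<in>\<MM>. embeds Z Y)"

definition minimal_universal :: "'a metric set \<Rightarrow> 'b metric \<Rightarrow> bool" where
  "minimal_universal \<MM> Y \<longleftrightarrow>
     universal \<MM> Y \<and> (\<forall>S\<subseteq>mspace Y. universal \<MM> (submetric Y S) \<longrightarrow> S = mspace Y)"

text \<open>The partition is indexed, so distinct indices always have disjoint parts, even where the
  family \<open>Y\<close> repeats a space.\<close>

definition is_disjoint_union :: "'b metric \<Rightarrow> 'i set \<Rightarrow> ('i \<Rightarrow> 'a metric) \<Rightarrow> bool" where
  "is_disjoint_union X I Y \<longleftrightarrow>
     (\<exists>P. mspace X = (\<Union>i\<in>I. P i) \<and> (\<forall>i\<in>I. P i \<noteq> {}) \<and> disjoint_family_on P I \<and>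
          (\<forall>i\<in>I. isometric (submetric X (P i)) (Y i)))"

end

theory Submission
  imports Defs
begin

text \<open>The whole theorem is governed by condition (iii): both minimality and (iii) say that the
  part \<open>P i\<close> of the partition is the only copy of \<open>Y i\<close> inside \<open>X\<close>.

  If \<open>X\<close> is minimal and \<open>T\<close> is a copy of \<open>Y i\<close>, then replacing \<open>P i\<close> by \<open>T\<close> in the partition leaves
  a universal subspace, which must be all of \<open>X\<close>; as the parts are disjoint, \<open>P i \<subseteq> T\<close>. Thus \<open>P i\<close> is
  the least copy of \<open>Y i\<close>. An isometry from \<open>T\<close> onto \<open>P i\<close> maps the copy \<open>P i\<close> to a copy inside \<open>P i\<close>,
  hence onto \<open>P i\<close>, and injectivity gives \<open>T = P i\<close> (\<open>least_copy_unique\<close>).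

  Conversely, a universal subspace contains a copy of every \<open>Y i\<close>, so by uniqueness it contains every
  part. Uniqueness of copies also yields (i) and (ii): an isometry from \<open>Y j\<close> onto \<open>P j\<close> would carry a
  proper subcopy of \<open>Y j\<close>, or a copy of another \<open>Y i\<close>, to a second copy inside \<open>P j\<close>.\<close>

definition copy_in :: "'a metric \<Rightarrow> 'b metric \<Rightarrow> 'b set \<Rightarrow> bool" where
  "copy_in Y X S \<longleftrightarrow> S \<subseteq> mspace X \<and> isometric Y (submetric X S)"

lemma distance_preserving_comp:
  assumes "distance_preserving X Y f" "distance_preserving Y Z g"
  shows "distance_preserving X Z (g \<circ> f)"
  using assms unfolding distance_preserving_def by (auto simp: Pi_iff)

lemma distance_preserving_inj_on:
  assumes "distance_preserving X Y f"
  shows "inj_on f (mspace X)"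
proof (rule inj_onI)
  fix x y assume x: "x \<in> mspace X" and y: "y \<in> mspace X" and "f x = f y"
  moreover have "f x \<in> mspace Y"
    using assms x by (auto simp: distance_preserving_def)
  ultimately have "mdist X x y = 0"
    using assms by (metis distance_preserving_def mdist_zero)
  then show "x = y" using x y by simp
qed

lemma isometric_sym:
  assumes "isometric X Y"
  shows "isometric Y X"
proof -
  obtain f where f: "distance_preserving X Y f" and b: "bij_betw f (mspace X) (mspace Y)"
    using assms by (auto simp: isometric_def)
  let ?g = "inv_into (mspace X) f"
  have g: "bij_betw ?g (mspace Y) (mspace X)"
    using b by (rule bij_betw_inv_into)
  have "mdist X (?g x) (?g y) = mdist Y x y" if "x \<in> mspace Y" "y \<in> mspace Y" for x y
  proof -
    have "?g x \<in> mspace X" "?g y \<in> mspace X"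
      using g that by (auto dest: bij_betwE)
    then have "mdist Y (f (?g x)) (f (?g y)) = mdist X (?g x) (?g y)"
      using f by (simp add: distance_preserving_def)
    then show ?thesis
      using b that by (simp add: bij_betw_inv_into_right)
  qed
  then have "distance_preserving Y X ?g"
    using g by (auto simp: distance_preserving_def dest: bij_betwE)
  then show ?thesis using g by (auto simp: isometric_def)
qed

lemma isometric_trans:
  assumes "isometric X Y" "isometric Y Z"
  shows "isometric X Z"
  using assms unfolding isometric_def
  by (meson bij_betw_trans distance_preserving_comp)

lemma distance_preserving_submetric_iff:
  assumes "S \<subseteq> mspace X"
  shows "distance_preserving Y (submetric X S) f \<longleftrightarrow>
    distance_preserving Y X f \<and> f ` mspace Y \<subseteq> S"
  using assms by (auto simp: distance_preserving_def)

lemma copy_in_image: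
  assumes "distance_preserving Y X f"
  shows "copy_in Y X (f ` mspace Y)"
proof -
  have sub: "f ` mspace Y \<subseteq> mspace X"
    using assms by (auto simp: distance_preserving_def)
  then have "distance_preserving Y (submetric X (f ` mspace Y)) f"
    using assms by (simp add: distance_preserving_submetric_iff)
  moreover have "bij_betw f (mspace Y) (mspace (submetric X (f ` mspace Y)))"
    using distance_preserving_inj_on[OF assms] sub by (simp add: bij_betw_def Int_absorb2)
  ultimately show ?thesis
    using sub by (auto simp: copy_in_def isometric_def)
qed

lemma copy_inE:
  assumes "copy_in Y X S"
  obtains f where "distance_preserving Y X f" "f ` mspace Y = S"
proof -
  obtain f where f: "distance_preserving Y (submetric X S) f"
    and b: "bij_betw f (mspace Y) (mspace (submetric X S))" and S: "S \<subseteq> mspace X"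
    using assms by (auto simp: copy_in_def isometric_def)
  have "f ` mspace Y = S"
    using b S by (auto simp: bij_betw_def)
  then show thesis
    using that f S by (simp add: distance_preserving_submetric_iff)
qed

lemma embeds_submetric_iff_copy:
  assumes "S \<subseteq> mspace X"
  shows "embeds Y (submetric X S) \<longleftrightarrow> (\<exists>T\<subseteq>S. copy_in Y X T)"
  using assms unfolding embeds_def
  by (metis copy_in_image copy_inE distance_preserving_submetric_iff)

text \<open>The three kinds of competing copy in the proof (inside a least copy, a shift of some \<open>Y i\<close>, and a
  foreign \<open>Y i\<close> inside \<open>Y j\<close>) are all found in another space first and carried into \<open>X\<close> by this lemma.\<close>

lemma copy_in_map:
  assumes "distance_preserving Y X f" "copy_in Z Y T"
  shows "copy_in Z X (f ` T)"
proof -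
  obtain h where h: "distance_preserving Z Y h" "h ` mspace Z = T"
    using assms(2) by (rule copy_inE)
  have "copy_in Z X ((f \<circ> h) ` mspace Z)"
    using distance_preserving_comp[OF h(1) assms(1)] by (rule copy_in_image)
  then show ?thesis using h(2) by (simp only: image_comp[symmetric])
qed

lemma copy_in_submetric:
  assumes "copy_in Y X T" "T \<subseteq> S"
  shows "copy_in Y (submetric X S) T"
  using assms by (auto simp: copy_in_def submetric_submetric Int_absorb1)

text \<open>A least copy is the only copy: an isometry from another copy \<open>T\<close> onto \<open>P\<close> compresses \<open>P \<subseteq> T\<close> to
  a copy inside \<open>P\<close>, so by leastness it already maps \<open>P\<close> onto \<open>P\<close>, and nothing of \<open>T\<close> is left over.\<close>

lemma least_copy_unique:
  assumes P: "copy_in Y X P" and least: "\<And>T. copy_in Y X T \<Longrightarrow> P \<subseteq> T" and T: "copy_in Y X T"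
  shows "T = P"
proof -
  have PT: "P \<subseteq> T" using least T .
  have TX: "T \<subseteq> mspace X" and PX: "P \<subseteq> mspace X"
    using T P by (auto simp: copy_in_def)
  have "isometric (submetric X T) (submetric X P)"
    using T P by (meson copy_in_def isometric_sym isometric_trans)
  then have "copy_in (submetric X T) X P"
    using PX by (simp add: copy_in_def)
  then obtain g where g: "distance_preserving (submetric X T) X g" and gT: "g ` T = P"
    using TX by (auto elim!: copy_inE simp: Int_absorb2 Int_absorb1)
  have "copy_in Y X (g ` P)"
    using g copy_in_submetric[OF P PT] by (rule copy_in_map)
  then have "P \<subseteq> g ` P" by (rule least)
  then have "g ` T \<subseteq> g ` P" using gT by simp
  moreover have "inj_on g T"
    using distance_preserving_inj_on[OF g] TX by (simp add: Int_absorb2)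
  ultimately have "T \<subseteq> P"
    using PT by (simp add: inj_on_image_subset_iff)
  then show ?thesis using PT by simp
qed

text \<open>A shift of \<open>Y\<close> is a proper subset of \<open>Y\<close> that is a copy of \<open>Y\<close>; the isometry onto the unique copy
  of \<open>Y\<close> in \<open>X\<close> sends it to a strictly smaller copy.\<close>

lemma unique_copy_not_shifted:
  assumes P: "copy_in Y X P" and unique: "\<And>T. copy_in Y X T \<Longrightarrow> T = P"
  shows "\<not> shifted Y"
proof
  assume "shifted Y"
  then obtain S where S: "S \<subseteq> mspace Y" "isometric (submetric Y S) Y" "S \<noteq> mspace Y"
    by (auto simp: shifted_def)
  obtain f where f: "distance_preserving Y X f" "f ` mspace Y = P"
    using P by (rule copy_inE)
  have "copy_in Y Y S"
    using S isometric_sym by (auto simp: copy_in_def)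
  then have "f ` S = f ` mspace Y"
    using unique copy_in_map[OF f(1)] f(2) by metis
  then show False
    using distance_preserving_inj_on[OF f(1)] S by (simp add: inj_on_image_eq_iff)
qed

theorem theorem6p8:
  fixes I :: "'i set" and Y :: "'i \<Rightarrow> 'a metric" and X :: "'b metric"
  assumes "I \<noteq> {}"
    and "\<And>i. i \<in> I \<Longrightarrow> mspace (Y i) \<noteq> {}"
    and "is_disjoint_union X I Y"
  shows "minimal_universal (Y ` I) X \<longleftrightarrow>
    (\<forall>i\<in>I. \<not> shifted (Y i)) \<and>
    (\<forall>i\<in>I. \<forall>j\<in>I. i \<noteq> j \<longrightarrow> \<not> comparable (Y i) (Y j)) \<and>
    (\<forall>i\<in>I. \<exists>!S. S \<subseteq> mspace X \<and> isometric (Y i) (submetric X S))"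
proof -
  obtain P where X: "mspace X = (\<Union>i\<in>I. P i)" and ne: "\<And>i. i \<in> I \<Longrightarrow> P i \<noteq> {}"
    and disj: "disjoint_family_on P I"
    and iso: "\<And>i. i \<in> I \<Longrightarrow> isometric (submetric X (P i)) (Y i)"
    using assms(3) unfolding is_disjoint_union_def by blast
  have P: "copy_in (Y i) X (P i)" if "i \<in> I" for i
    using that X isometric_sym[OF iso[OF that]] by (auto simp: copy_in_def)
  have universal_iff: "universal (Y ` I) (submetric X S) \<longleftrightarrow> (\<forall>i\<in>I. \<exists>T\<subseteq>S. copy_in (Y i) X T)"
    if "S \<subseteq> mspace X" for S
    using that by (simp add: universal_def embeds_submetric_iff_copy)
  define unique where "unique \<longleftrightarrow> (\<forall>i\<in>I. \<forall>T. copy_in (Y i) X T \<longrightarrow> T = P i)"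
  have unique_iff: "unique \<longleftrightarrow> (\<forall>i\<in>I. \<exists>!S. S \<subseteq> mspace X \<and> isometric (Y i) (submetric X S))"
    using P unfolding unique_def copy_in_def[symmetric] by metis
  have "unique" if min: "minimal_universal (Y ` I) X"
  proof -
    have "P i \<subseteq> T" if i: "i \<in> I" and T: "copy_in (Y i) X T" for i T
    proof -
      \<comment> \<open>The partition with the part \<open>P i\<close> exchanged for the rival copy \<open>T\<close>.\<close>
      let ?S = "T \<union> (\<Union>j\<in>I - {i}. P j)"
      have S: "?S \<subseteq> mspace X"
        using T X by (auto simp: copy_in_def)
      have "\<exists>U\<subseteq>?S. copy_in (Y j) X U" if "j \<in> I" for j
      proof (cases "j = i")
        case True
        then show ?thesis using T by blast
      next
        case False
        then have "P j \<subseteq> ?S" using that by blast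
        then show ?thesis using P that by blast
      qed
      then have "universal (Y ` I) (submetric X ?S)"
        using universal_iff[OF S] by simp
      then have "?S = mspace X"
        using min S unfolding minimal_universal_def by blast
      then have "P i \<subseteq> ?S" using X i by blast
      moreover have "P i \<inter> P j = {}" if "j \<in> I - {i}" for j
        using disj i that by (auto simp: disjoint_family_on_def)
      ultimately show "P i \<subseteq> T" by blast
    qed
    then show "unique"
      unfolding unique_def using P least_copy_unique by metis
  qed
  moreover have "minimal_universal (Y ` I) X" if unique
    unfolding minimal_universal_def
  proof (intro conjI allI impI)
    show "universal (Y ` I) X"
      using P unfolding universal_def embeds_def by (blast elim: copy_inE)
    fix S assume S: "S \<subseteq> mspace X" and "universal (Y ` I) (submetric X S)"
    then have "\<forall>i\<in>I. P i \<subseteq> S"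
      using \<open>unique\<close> universal_iff[OF S] unfolding unique_def by metis
    then show "S = mspace X" using S X by blast
  qed
  moreover have "\<not> shifted (Y i)" if unique "i \<in> I" for i
    using that P unique_copy_not_shifted unfolding unique_def by metis
  moreover have "\<not> comparable (Y i) (Y j)" if unique and ij: "i \<in> I" "j \<in> I" "i \<noteq> j" for i j
  proof -
    have "\<not> embeds (Y k) (Y l)" if kl: "k \<in> I" "l \<in> I" "k \<noteq> l" for k l
    proof
      assume "embeds (Y k) (Y l)"
      then obtain h where h: "distance_preserving (Y k) (Y l) h"
        by (auto simp: embeds_def)
      obtain f where f: "distance_preserving (Y l) X f" "f ` mspace (Y l) = P l"
        using P[OF kl(2)] by (rule copy_inE)
      have "copy_in (Y k) X (f ` h ` mspace (Y k))"
        using f(1) copy_in_image[OF h] by (rule copy_in_map)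
      then have "f ` h ` mspace (Y k) = P k"
        using \<open>unique\<close> kl(1) unfolding unique_def by blast
      moreover have "h ` mspace (Y k) \<subseteq> mspace (Y l)"
        using h by (auto simp: distance_preserving_def)
      ultimately have "P k \<subseteq> P l" using f(2) by blast
      then show False
        using disj kl ne[OF kl(1)] by (auto simp: disjoint_family_on_def)
    qed
    then show ?thesis using ij by (auto simp: comparable_def)
  qed
  ultimately show ?thesis
    unfolding unique_iff[symmetric] by blast
qed

end
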